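(* Let $X$ be a nonempty complete metric space without isolated points, and let $f:X\to\mathbb{R}$ be a function. If there is a dense set $A\subset X$ such that $f$ is continuous on $A$, then there is an uncountable dense set $B\subset X$ such that $f$ is continuous on $B$.
   Context: A function $f:X\to\mathbb{R}$ is said to be continuous on a set $A\subset X$ if $f$, as a function on all of $X$, is continuous at each point of $A$; this is different from the restriction $f|_A$ being continuous. *)

theory Defs
  imports "HOL-Analysis.Analysis"
begin

end

theory Submission
  imports Defs
begin

text \<open>
  The set \<open>C\<close> of continuity points of \<open>f\<close> is the intersection of the open sets \<open>U n\<close> of points
  having a neighbourhood on which \<open>f\<close> oscillates by less than \<open>1 / (n + 1)\<close>, and each \<open>U n\<close> is
  dense because it contains \<open>A\<close>. Complements of singletons are open and dense as well, since
  there are no isolated points. If \<open>C\<close> were countable, the sets \<open>U n\<close> together with the sets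
  \<open>- {c}\<close> for \<open>c \<in> C\<close> would be countably many dense open sets with empty intersection,
  contradicting Baire's theorem. So \<open>B = C\<close> works.
\<close>

text \<open>As a union of open sets this is open for every \<open>f\<close>, continuous or
  not.\<close>

definition small_osc :: "('a::topological_space \<Rightarrow> 'b::metric_space) \<Rightarrow> real \<Rightarrow> 'a set" where
  "small_osc f e = \<Union>{V. open V \<and> (\<forall>y\<in>V. \<forall>z\<in>V. dist (f y) (f z) < e)}"

lemma open_small_osc: "open (small_osc f e)"
  unfolding small_osc_def by auto

lemma isCont_imp_small_osc:
  fixes f :: "'a::t2_space \<Rightarrow> 'b::metric_space"
  assumes "isCont f x" "e > 0"
  shows "x \<in> small_osc f e"
proof -
  \<comment> \<open>The radius is halved because two points of \<open>V\<close> are compared through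
    \<open>f x\<close>.\<close>
  have "\<exists>V. open V \<and> x \<in> V \<and> (\<forall>y\<in>V. f y \<in> ball (f x) (e/2))"
    using assms by (simp add: continuous_at_open del: mem_ball)
  then obtain V where "open V" "x \<in> V" and V: "\<forall>y\<in>V. f y \<in> ball (f x) (e/2)"
    by blast
  moreover have "dist (f y) (f z) < e" if "y \<in> V" "z \<in> V" for y z
    using V that dist_triangle_half_r[of "f x" "f y" e "f z"] by simp
  ultimately show ?thesis
    unfolding small_osc_def by blast
qed

lemma isCont_iff_small_osc:
  fixes f :: "'a::t2_space \<Rightarrow> 'b::metric_space"
  shows "isCont f x \<longleftrightarrow> (\<forall>n. x \<in> small_osc f (inverse (Suc n)))"
proof
  assume "isCont f x"
  then show "\<forall>n. x \<in> small_osc f (inverse (Suc n))"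
    by (auto intro: isCont_imp_small_osc)
next
  assume osc: "\<forall>n. x \<in> small_osc f (inverse (Suc n))"
  have "\<forall>\<^sub>F y in at x. dist (f y) (f x) < e" if "e > 0" for e
  proof -
    obtain n where n: "inverse (Suc n) < e"
      using reals_Archimedean[OF \<open>e > 0\<close>] by auto
    have "x \<in> small_osc f (inverse (Suc n))"
      using osc by blast
    then obtain V where "open V" "x \<in> V" and V: "\<forall>y\<in>V. \<forall>z\<in>V. dist (f y) (f z) < inverse (Suc n)"
      unfolding small_osc_def by blast
    have "\<forall>\<^sub>F y in at x. y \<in> V"
      using \<open>open V\<close> \<open>x \<in> V\<close> by (rule eventually_at_in_open')
    then show ?thesis
    proof eventually_elim
      case (elim y)
      \<comment> \<open>The bound on \<open>V\<close> covers all pairs, so \<open>x\<close> can be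
        the second point.\<close>
      then show ?case
        using V \<open>x \<in> V\<close> n by fastforce
    qed
  qed
  then show "isCont f x"
    by (simp add: isCont_def tendsto_iff)
qed

lemma uncountable_dense_Inter:
  fixes \<G> :: "'a::{complete_space, perfect_space} set set"
  assumes "countable \<G>" and \<G>: "\<And>T. T \<in> \<G> \<Longrightarrow> open T \<and> closure T = UNIV"
  shows "uncountable (\<Inter>\<G>)"
proof
  assume "countable (\<Inter>\<G>)"
  define \<H> where "\<H> = \<G> \<union> (\<lambda>c. - {c}) ` \<Inter>\<G>"
  have "euclidean closure_of \<Inter>\<H> = topspace (euclidean :: 'a topology)"
  proof (rule Baire_category)
    show "countable \<H>"
      using \<open>countable \<G>\<close> \<open>countable (\<Inter>\<G>)\<close> by (simp add: \<H>_def)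
    \<comment> \<open>Density of \<open>- {c}\<close> amounts to \<open>{c}\<close> having empty
      interior, which holds in a \<open>perfect_space\<close>.\<close>
    have "open (- {c}) \<and> closure (- {c}) = UNIV" for c :: 'a
      by (simp add: closure_complement open_Compl)
    then show "openin euclidean T \<and> euclidean closure_of T = topspace euclidean"
      if "T \<in> \<H>" for T
      using that \<G> unfolding \<H>_def by auto
  qed (simp add: completely_metrizable_space_euclidean)
  moreover have "\<Inter>\<H> = {}"
    unfolding \<H>_def by blast
  \<comment> \<open>The empty set would be dense, but a type is never empty.\<close>
  ultimately show False
    by simp
qed

theorem theorem1:
  fixes f :: "'a::{complete_space, perfect_space} \<Rightarrow> real"
  assumes "\<exists>A. closure A = UNIV \<and> (\<forall>x\<in>A. isCont f x)"
  shows "\<exists>B. uncountable B \<and> closure B = UNIV \<and> (\<forall>x\<in>B. isCont f x)"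
proof -
  let ?C = "{x. isCont f x}" and ?U = "\<lambda>n::nat. small_osc f (inverse (Suc n))"
  obtain A where A: "closure A = UNIV" "A \<subseteq> ?C"
    using assms by blast
  have C: "?C = \<Inter>(range ?U)"
    by (auto simp: isCont_iff_small_osc)
  \<comment> \<open>Needed twice: for each \<open>?U n\<close>, and for \<open>?C\<close> itself as
    the witness.\<close>
  have dense: "closure T = UNIV" if "A \<subseteq> T" for T
    using closure_mono[OF that] A(1) by auto
  have "uncountable ?C"
    unfolding C
  proof (rule uncountable_dense_Inter)
    show "open T \<and> closure T = UNIV" if "T \<in> range ?U" for T
      using that A(2) C by (auto simp: open_small_osc intro!: dense)
  qed simp
  then show ?thesis
    using dense[OF A(2)] by blast
qed

end
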